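(* Let $q>2$ be a power of $2$, let $\delta\in\mathbb{F}_q$ have absolute trace $1$, and let $\epsilon\in\mathbb{F}_{q^2}\setminus\mathbb{F}_q$ satisfy $\epsilon^2+\epsilon+\delta=0$. Let $a=a_0+\epsilon a_1\in\mathbb{F}_{q^2}^*$, $b=b_0+\epsilon b_1\in\mathbb{F}_{q^2}\setminus\mathbb{F}_q$ ($a_i,b_i\in\mathbb{F}_q$), and let $\mathcal{M}_{a,b}$ be the BM quasi-Hermitian variety of $\mathrm{PG}(3,q^2)$: \[ \mathcal{M}_{a,b}=\{(1,x,y,z): z+a(x^2+y^2)-b(x^{q+1}+y^{q+1})\in\mathbb{F}_q\}\ \cup\ \{(0,X,Y,Z): X^{q+1}+Y^{q+1}=0\}. \] Then in the Barlotti--Cofman representation in $\mathrm{PG}(6,q)$ the affine points of $\mathcal{M}_{a,b}$ correspond to the affine points of the quadratic cone $\mathcal{B}'$ with equation \[ x_0x_6+a_0(x_2^2+x_4^2)+a_1(x_1^2+x_2^2+\delta x_2^2+x_3^2+x_4^2+\delta x_4^2)+b_1(x_1^2+\delta x_2^2+x_1x_2+x_3^2+\delta x_4^2+x_3x_4)=0, \] which has vertex $V=(0,0,0,0,0,1,0)$ and whose base is a hyperbolic quadric. The points at infinity of $\mathcal{M}_{a,b}$ are represented by $q^3+q^2+1$ lines of the spread $\mathcal{S}$, namely the lines $r_P$ for $P\in\{(0,X,Y,Z):X^{q+1}+Y^{q+1}=0\}$, and among these lines $q^2+1$ are contained in $\mathcal{B}'$.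
   Context: Points of $\mathrm{PG}(3,q^2)$ have homogeneous coordinates $(J,X,Y,Z)$, with plane at infinity $J=0$ and affine points $(1,x,y,z)$; points of $\mathrm{PG}(6,q)$ have homogeneous coordinates $(x_0,\dots,x_6)$, with hyperplane at infinity $x_0=0$. Every $c\in\mathbb{F}_{q^2}$ is written uniquely as $c=c_0+\epsilon c_1$, $c_0,c_1\in\mathbb{F}_q$. Barlotti--Cofman representation: the affine point $(1,x,y,z)$ with $x=x_1+\epsilon x_2$, $y=x_3+\epsilon x_4$, $z=x_5+\epsilon x_6$ corresponds to $(1,x_1,\dots,x_6)$; a point $P=(0,u,v,w)$ at infinity corresponds to the spread line $r_P$ of $\{x_0=0\}$ consisting of the points $(0,u'_0,u'_1,v'_0,v'_1,w'_0,w'_1)$ with $(u',v',w')=(\lambda u,\lambda v,\lambda w)$, $\lambda\in\mathbb{F}_{q^2}^*$. The lines $r_P$ form a Desarguesian line spread $\mathcal{S}$ of $\{x_0=0\}$. The base of $\mathcal{B}'$ is the quadric of $\mathrm{PG}(5,q)$ in coordinates $x_0,x_1,x_2,x_3,x_4,x_6$ given by the same equation. *)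

theory Defs
  imports "HOL-Analysis.Analysis"
begin

text \<open>
  Projective spaces over a field: a point is the one-dimensional subspace of its homogeneous
  coordinate vectors. Index types are the numeral types \<open>4\<close>, \<open>6\<close>, \<open>7\<close>, whose elements are
  \<open>0, 1, \<dots>\<close> (residues), so coordinates are numbered from \<open>0\<close>; coordinate \<open>0\<close>
  always defines the hyperplane at infinity.
\<close>

definition proj_pt :: "'a::field^'n \<Rightarrow> ('a^'n) set" where
  "proj_pt v = vec.span {v}"

definition PG_points :: "('a::field^'n) set set" where
  "PG_points = {proj_pt v | v. v \<noteq> 0}"

definition points_of :: "('a::field^'n) set \<Rightarrow> ('a^'n) set set" where
  "points_of W = {P \<in> PG_points. P \<subseteq> W}"

definition PG_lines :: "('a::field^'n) set set set" where
  "PG_lines = {points_of W | W. vec.subspace W \<and> vec.dim W = 2}"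

definition hyperplane_inf :: "('a::field^('n::{finite,zero})) set" where
  "hyperplane_inf = {v. v $ 0 = 0}"

definition affine_part :: "('a::field^('n::{finite,zero})) set set \<Rightarrow> ('a^('n::{finite,zero})) set set" where
  "affine_part S = {P \<in> S. \<not> P \<subseteq> hyperplane_inf}"

definition infinite_part :: "('a::field^('n::{finite,zero})) set set \<Rightarrow> ('a^('n::{finite,zero})) set set" where
  "infinite_part S = {P \<in> S. P \<subseteq> hyperplane_inf}"

definition hom4 :: "'a \<Rightarrow> 'a \<Rightarrow> 'a \<Rightarrow> 'a \<Rightarrow> 'a^4" where
  "hom4 j x y z = (\<chi> i. if i = 0 then j else if i = 1 then x else if i = 2 then y else z)"

definition hom7 :: "'a \<Rightarrow> 'a \<Rightarrow> 'a \<Rightarrow> 'a \<Rightarrow> 'a \<Rightarrow> 'a \<Rightarrow> 'a \<Rightarrow> 'a^7" where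
  "hom7 x0 x1 x2 x3 x4 x5 x6 =
     (\<chi> i. if i = 0 then x0 else if i = 1 then x1 else if i = 2 then x2 else if i = 3 then x3
          else if i = 4 then x4 else if i = 5 then x5 else x6)"

definition quadric :: "('a::field^'n \<Rightarrow> 'a) \<Rightarrow> ('a^'n) set set" where
  "quadric Q = {proj_pt v | v. v \<noteq> 0 \<and> Q v = 0}"

text \<open>
  The singular points of the quadric of a quadratic form \<open>Q\<close>. In characteristic \<open>2\<close> the
  condition \<open>Q v = 0\<close> does not follow from \<open>v\<close> being in the radical of the polar form.
\<close>

definition singular_points :: "('a::field^'n \<Rightarrow> 'a) \<Rightarrow> ('a^'n) set set" where
  "singular_points Q =
     {proj_pt v | v. v \<noteq> 0 \<and> Q v = 0 \<and> (\<forall>w. Q (v + w) - Q v - Q w = 0)}"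

definition cone_over :: "('a::field^'n) set \<Rightarrow> ('a^'n) set set \<Rightarrow> ('a^'n) set set" where
  "cone_over V T = insert V (\<Union>P\<in>T. points_of (vec.span (V \<union> P)))"

text \<open>
  Hyperbolic quadrics of the five-dimensional projective space: those projectively equivalent
  to the quadric with canonical equation \<open>x\<^sub>0x\<^sub>1 + x\<^sub>2x\<^sub>3 + x\<^sub>4x\<^sub>5 = 0\<close>.
\<close>

definition hyperbolic_form5 :: "'a::field^6 \<Rightarrow> 'a" where
  "hyperbolic_form5 x = x $ 0 * x $ 1 + x $ 2 * x $ 3 + x $ 4 * x $ 5"

definition hyperbolic_quadric5 :: "('a::field^6) set set \<Rightarrow> bool" where
  "hyperbolic_quadric5 S \<longleftrightarrow>
     (\<exists>A :: 'a^6^6. invertible A \<and> S = quadric (\<lambda>x. hyperbolic_form5 (A *v x)))"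

text \<open>
  The extension of \<open>F\<^sub>q\<close> by \<open>F\<^sub>q\<^sup>2\<close> is given by two finite field types \<open>'f\<close>, \<open>'g\<close> and an
  embedding \<open>\<iota> :: 'f \<Rightarrow> 'g\<close> (necessarily injective); the subfield \<open>F\<^sub>q\<close> is \<open>range \<iota>\<close>.
\<close>

definition field_embedding :: "('f::field \<Rightarrow> 'g::field) \<Rightarrow> bool" where
  "field_embedding \<iota> \<longleftrightarrow>
     \<iota> 1 = 1 \<and> (\<forall>x y. \<iota> (x + y) = \<iota> x + \<iota> y) \<and> (\<forall>x y. \<iota> (x * y) = \<iota> x * \<iota> y)"

text \<open>The trace from the field with \<open>2^h\<close> elements to its prime field.\<close>

definition abs_trace2 :: "nat \<Rightarrow> 'f::field \<Rightarrow> 'f" where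
  "abs_trace2 h x = (\<Sum>i<h. x ^ (2 ^ i))"

definition BM_infinity :: "nat \<Rightarrow> ('g::field^4) set set" where
  "BM_infinity q =
     {proj_pt (hom4 0 X Y Z) | X Y Z. (X, Y, Z) \<noteq> (0, 0, 0) \<and> X ^ (q + 1) + Y ^ (q + 1) = 0}"

definition BM_variety :: "('f::{field,finite} \<Rightarrow> 'g::field) \<Rightarrow> 'g \<Rightarrow> 'g \<Rightarrow> ('g^4) set set" where
  "BM_variety \<iota> a b =
     {proj_pt (hom4 1 x y z) | x y z.
        z + a * (x\<^sup>2 + y\<^sup>2) - b * (x ^ (CARD('f) + 1) + y ^ (CARD('f) + 1)) \<in> range \<iota>}
     \<union> BM_infinity CARD('f)"

text \<open>
  The Barlotti--Cofman representation with respect to the basis \<open>1, \<epsilon>\<close>: affine points go to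
  affine points, points at infinity go to lines (sets of points) of the hyperplane at infinity.
\<close>

definition bc_affine ::
    "('f::field \<Rightarrow> 'g::field) \<Rightarrow> 'g \<Rightarrow> ('g^4) set \<Rightarrow> ('f^7) set" where
  "bc_affine \<iota> \<epsilon> P =
     (THE R. \<exists>x1 x2 x3 x4 x5 x6.
        P = proj_pt (hom4 1 (\<iota> x1 + \<epsilon> * \<iota> x2) (\<iota> x3 + \<epsilon> * \<iota> x4) (\<iota> x5 + \<epsilon> * \<iota> x6)) \<and>
        R = proj_pt (hom7 1 x1 x2 x3 x4 x5 x6))"

definition bc_line ::
    "('f::field \<Rightarrow> 'g::field) \<Rightarrow> 'g \<Rightarrow> ('g^4) set \<Rightarrow> ('f^7) set set" where
  "bc_line \<iota> \<epsilon> P =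
     {proj_pt (hom7 0 u0 u1 v0 v1 w0 w1) | u0 u1 v0 v1 w0 w1.
        \<exists>u v w l. (u, v, w) \<noteq> (0, 0, 0) \<and> P = proj_pt (hom4 0 u v w) \<and> l \<noteq> 0 \<and>
          \<iota> u0 + \<epsilon> * \<iota> u1 = l * u \<and> \<iota> v0 + \<epsilon> * \<iota> v1 = l * v \<and> \<iota> w0 + \<epsilon> * \<iota> w1 = l * w}"

definition bc_spread :: "('f::field \<Rightarrow> 'g::field) \<Rightarrow> 'g \<Rightarrow> ('f^7) set set set" where
  "bc_spread \<iota> \<epsilon> = bc_line \<iota> \<epsilon> ` infinite_part PG_points"

definition cone_form :: "'f::field \<Rightarrow> 'f \<Rightarrow> 'f \<Rightarrow> 'f \<Rightarrow> 'f^7 \<Rightarrow> 'f" where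
  "cone_form \<delta> a0 a1 b1 x =
     x $ 0 * x $ 6 + a0 * ((x $ 2)\<^sup>2 + (x $ 4)\<^sup>2)
     + a1 * ((x $ 1)\<^sup>2 + (x $ 2)\<^sup>2 + \<delta> * (x $ 2)\<^sup>2 + (x $ 3)\<^sup>2 + (x $ 4)\<^sup>2 + \<delta> * (x $ 4)\<^sup>2)
     + b1 * ((x $ 1)\<^sup>2 + \<delta> * (x $ 2)\<^sup>2 + x $ 1 * x $ 2 + (x $ 3)\<^sup>2 + \<delta> * (x $ 4)\<^sup>2 + x $ 3 * x $ 4)"

text \<open>
  The five-dimensional space with coordinates \<open>x\<^sub>0, x\<^sub>1, x\<^sub>2, x\<^sub>3, x\<^sub>4, x\<^sub>6\<close>, as the hyperplane
  \<open>x\<^sub>5 = 0\<close>; note that \<open>x\<^sub>6\<close> is stored at index \<open>5\<close> of the six-dimensional vector.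
\<close>

definition base_incl :: "'f^6 \<Rightarrow> 'f::field^7" where
  "base_incl y = hom7 (y $ 0) (y $ 1) (y $ 2) (y $ 3) (y $ 4) 0 (y $ 5)"

end

theory Submission
  imports Defs "HOL-Computational_Algebra.Polynomial"
begin

text \<open>
  Since \<open>\<epsilon>\<^sup>2 = \<epsilon> + \<delta>\<close>, iterating the Frobenius map \<open>h\<close> times gives
  \<open>\<epsilon>\<^sup>q = \<epsilon> + Tr(\<delta>) = \<epsilon> + 1\<close>, so that \<open>(x + \<epsilon>y)\<^bsup>q+1\<^esup> = x\<^sup>2 + xy + \<delta>y\<^sup>2\<close>. The equation of the
  affine part of the variety says that the \<open>\<epsilon>\<close>-coordinate of its left-hand side vanishes, and this
  coordinate is the quadratic form of the cone.

  With \<open>u = x\<^sub>1 + x\<^sub>3\<close> and \<open>v = x\<^sub>2 + x\<^sub>4\<close> this form becomes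
  \<open>x\<^sub>0x\<^sub>6 + u(\<alpha>u + b\<^sub>1x\<^sub>2) + v(\<gamma>v + b\<^sub>1u + b\<^sub>1x\<^sub>1)\<close> in characteristic \<open>2\<close>, with constants
  \<open>\<alpha>\<close>, \<open>\<gamma>\<close>, so its base is hyperbolic because \<open>b\<^sub>1 \<noteq> 0\<close>.

  At infinity there is the point \<open>(0,0,0,1)\<close>, and the points \<open>(0,1,y,z)\<close> with \<open>y\<close> one of the \<open>q + 1\<close>
  elements of norm \<open>1\<close>. On the line of \<open>(0,x,y,z)\<close> the form takes the values \<open>Im(\<lambda>\<^sup>2 a (x + y)\<^sup>2)\<close>;
  as \<open>\<lambda>\<^sup>2\<close> takes all values, the line lies on the cone iff \<open>x = y\<close>.
\<close>

section \<open>Coordinate vectors over the index types\<close>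

lemma exhaust_7:
  fixes i :: 7
  shows "i = 0 \<or> i = 1 \<or> i = 2 \<or> i = 3 \<or> i = 4 \<or> i = 5 \<or> i = 6"
proof (induct i)
  case (of_int z)
  then have "z = 0 \<or> z = 1 \<or> z = 2 \<or> z = 3 \<or> z = 4 \<or> z = 5 \<or> z = 6" by auto
  then show ?case by auto
qed

lemma exhaust_6:
  fixes i :: 6
  shows "i = 0 \<or> i = 1 \<or> i = 2 \<or> i = 3 \<or> i = 4 \<or> i = 5"
proof (induct i)
  case (of_int z)
  then have "z = 0 \<or> z = 1 \<or> z = 2 \<or> z = 3 \<or> z = 4 \<or> z = 5" by auto
  then show ?case by auto
qed

lemma forall_7: "(\<forall>i::7. P i) \<longleftrightarrow> P 0 \<and> P 1 \<and> P 2 \<and> P 3 \<and> P 4 \<and> P 5 \<and> P 6"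
  by (metis exhaust_7)

lemma forall_6: "(\<forall>i::6. P i) \<longleftrightarrow> P 0 \<and> P 1 \<and> P 2 \<and> P 3 \<and> P 4 \<and> P 5"
  by (metis exhaust_6)

text \<open>The rule \<open>forall_4\<close> numbers the indices from 1 to 4, while homogeneous
  coordinates start at 0; in this residue type the index 4 is 0.\<close>

lemma forall_4_from_0: "(\<forall>i::4. P i) \<longleftrightarrow> P 0 \<and> P 1 \<and> P 2 \<and> P 3"
proof -
  have eq: "(4 :: 4) = 0" by simp
  show ?thesis unfolding forall_4 eq by blast
qed

text \<open>Vectors of the space carrying the base of the cone; when passed to
  \<open>base_incl\<close>, the last argument is the coordinate \<open>x\<^sub>6\<close>, and
  \<open>x\<^sub>5\<close> is absent.\<close>

definition hom6 :: "'a \<Rightarrow> 'a \<Rightarrow> 'a \<Rightarrow> 'a \<Rightarrow> 'a \<Rightarrow> 'a \<Rightarrow> 'a^6" where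
  "hom6 x0 x1 x2 x3 x4 x5 =
     (\<chi> i. if i = 0 then x0 else if i = 1 then x1 else if i = 2 then x2 else if i = 3 then x3
          else if i = 4 then x4 else x5)"

lemma hom4_nth [simp]:
  "hom4 j x y z $ 0 = j" "hom4 j x y z $ 1 = x" "hom4 j x y z $ 2 = y" "hom4 j x y z $ 3 = z"
  by (simp_all add: hom4_def)

lemma hom6_nth [simp]:
  "hom6 x0 x1 x2 x3 x4 x5 $ 0 = x0" "hom6 x0 x1 x2 x3 x4 x5 $ 1 = x1"
  "hom6 x0 x1 x2 x3 x4 x5 $ 2 = x2" "hom6 x0 x1 x2 x3 x4 x5 $ 3 = x3"
  "hom6 x0 x1 x2 x3 x4 x5 $ 4 = x4" "hom6 x0 x1 x2 x3 x4 x5 $ 5 = x5"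
  by (simp_all add: hom6_def)

lemma hom7_nth [simp]:
  "hom7 x0 x1 x2 x3 x4 x5 x6 $ 0 = x0" "hom7 x0 x1 x2 x3 x4 x5 x6 $ 1 = x1"
  "hom7 x0 x1 x2 x3 x4 x5 x6 $ 2 = x2" "hom7 x0 x1 x2 x3 x4 x5 x6 $ 3 = x3"
  "hom7 x0 x1 x2 x3 x4 x5 x6 $ 4 = x4" "hom7 x0 x1 x2 x3 x4 x5 x6 $ 5 = x5"
  "hom7 x0 x1 x2 x3 x4 x5 x6 $ 6 = x6"
  by (simp_all add: hom7_def)

lemma hom4_inject [simp]:
  "hom4 j x y z = hom4 j' x' y' z' \<longleftrightarrow> j = j' \<and> x = x' \<and> y = y' \<and> z = z'"
  by (auto simp: vec_eq_iff forall_4_from_0)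

lemma hom7_inject [simp]:
  "hom7 x0 x1 x2 x3 x4 x5 x6 = hom7 y0 y1 y2 y3 y4 y5 y6 \<longleftrightarrow>
     x0 = y0 \<and> x1 = y1 \<and> x2 = y2 \<and> x3 = y3 \<and> x4 = y4 \<and> x5 = y5 \<and> x6 = y6"
  by (auto simp: vec_eq_iff forall_7)

lemma hom4_eq_0 [simp]: "hom4 j x y z = 0 \<longleftrightarrow> j = 0 \<and> x = 0 \<and> y = 0 \<and> z = 0"
  by (auto simp: vec_eq_iff forall_4_from_0)

lemma hom7_eq_0 [simp]:
  "hom7 x0 x1 x2 x3 x4 x5 x6 = 0 \<longleftrightarrow>
     x0 = 0 \<and> x1 = 0 \<and> x2 = 0 \<and> x3 = 0 \<and> x4 = 0 \<and> x5 = 0 \<and> x6 = 0"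
  by (auto simp: vec_eq_iff forall_7)

lemma scale_hom4 [simp]: "c *s hom4 j x y z = hom4 (c * j) (c * x) (c * y) (c * z)"
  by (auto simp: vec_eq_iff forall_4_from_0)

lemma scale_hom7 [simp]:
  "c *s hom7 x0 x1 x2 x3 x4 x5 x6 =
     hom7 (c * x0) (c * x1) (c * x2) (c * x3) (c * x4) (c * x5) (c * x6)"
  by (auto simp: vec_eq_iff forall_7)

lemma add_hom7 [simp]:
  "hom7 x0 x1 x2 x3 x4 x5 x6 + hom7 y0 y1 y2 y3 y4 y5 y6 =
     hom7 (x0 + y0) (x1 + y1) (x2 + y2) (x3 + y3) (x4 + y4) (x5 + y5) (x6 + y6)"
  by (auto simp: vec_eq_iff forall_7)

lemma hom7_eta: "v = hom7 (v $ 0) (v $ 1) (v $ 2) (v $ 3) (v $ 4) (v $ 5) (v $ 6)"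
  by (auto simp: vec_eq_iff forall_7)

lemma hom7_cases: obtains x0 x1 x2 x3 x4 x5 x6 where "v = hom7 x0 x1 x2 x3 x4 x5 x6"
  using hom7_eta by blast

section \<open>Projective points and their representatives\<close>

lemma mem_proj_pt: "w \<in> proj_pt v \<longleftrightarrow> (\<exists>c. w = c *s v)"
  by (auto simp: proj_pt_def vec.span_singleton)

lemma proj_pt_self: "v \<in> proj_pt v"
  by (simp add: proj_pt_def vec.span_base)

lemma subspace_proj_pt: "vec.subspace (proj_pt v)"
  by (simp add: proj_pt_def)

lemma proj_pt_subset_iff: "vec.subspace W \<Longrightarrow> proj_pt v \<subseteq> W \<longleftrightarrow> v \<in> W"
  unfolding proj_pt_def by (auto intro: vec.span_base dest: vec.span_minimal[rotated, of _ "{v}"])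

lemma proj_pt_eq_iff:
  assumes "v \<noteq> 0"
  shows "proj_pt v = proj_pt w \<longleftrightarrow> (\<exists>c. c \<noteq> 0 \<and> v = c *s w)"
proof
  assume "proj_pt v = proj_pt w"
  then obtain c where "v = c *s w" using proj_pt_self mem_proj_pt by blast
  then show "\<exists>c. c \<noteq> 0 \<and> v = c *s w" using assms by auto
next
  assume "\<exists>c. c \<noteq> 0 \<and> v = c *s w"
  then obtain c where c: "c \<noteq> 0" "v = c *s w" by auto
  then have "w = inverse c *s v" by (simp add: vector_smult_assoc)
  with c(2) have "v \<in> proj_pt w" "w \<in> proj_pt v" by (auto simp only: mem_proj_pt)
  then have "proj_pt v \<subseteq> proj_pt w" "proj_pt w \<subseteq> proj_pt v"
    by (simp_all add: proj_pt_subset_iff subspace_proj_pt)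
  then show "proj_pt v = proj_pt w" by blast
qed

lemma proj_pt_scale: "c \<noteq> 0 \<Longrightarrow> v \<noteq> 0 \<Longrightarrow> proj_pt (c *s v) = proj_pt v"
  by (subst proj_pt_eq_iff) auto

lemma subspace_hyperplane_inf: "vec.subspace hyperplane_inf"
  by (auto simp: vec.subspace_def hyperplane_inf_def)

lemma proj_pt_subset_hyperplane_inf: "proj_pt v \<subseteq> hyperplane_inf \<longleftrightarrow> v $ 0 = 0"
  by (simp add: proj_pt_subset_iff[OF subspace_hyperplane_inf]) (simp add: hyperplane_inf_def)

text \<open>The leading coordinate 1 on both sides forces the scalar between the two representatives
  to be 1.\<close>

lemma proj_pt_hom7_affine:
  "proj_pt (hom7 1 x1 x2 x3 x4 x5 x6) = proj_pt (hom7 1 y1 y2 y3 y4 y5 y6) \<longleftrightarrow>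
     hom7 1 x1 x2 x3 x4 x5 x6 = (hom7 1 y1 y2 y3 y4 y5 y6)"
  by (auto simp: proj_pt_eq_iff)

lemma proj_pt_hom4_infinity: "proj_pt (hom4 0 u v w) = proj_pt (hom4 0 u' v' w') \<longleftrightarrow>
    (\<exists>c. c \<noteq> 0 \<and> u = c * u' \<and> v = c * v' \<and> w = c * w')" if "(u, v, w) \<noteq> (0, 0, 0)"
  using that by (subst proj_pt_eq_iff) auto

lemma hom4_affine_not_at_infinity: "\<not> proj_pt (hom4 1 x y z) \<subseteq> hyperplane_inf"
  by (simp add: proj_pt_subset_hyperplane_inf)

lemma BM_infinity_at_infinity: "P \<in> BM_infinity n \<Longrightarrow> P \<subseteq> hyperplane_inf"
  unfolding BM_infinity_def
  by (elim CollectE exE conjE) (simp only: proj_pt_subset_hyperplane_inf hom4_nth)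

text \<open>Membership in \<open>quadric\<close> only asks for some representative that is a zero of
  \<open>Q\<close>. Homogeneity of degree 2 makes the choice irrelevant, so any given representative
  can be tested.\<close>

lemma proj_pt_in_quadric:
  fixes Q :: "'a::field^'n \<Rightarrow> 'a"
  assumes "v \<noteq> 0" and hom: "\<And>c v. Q (c *s v) = c\<^sup>2 * Q v"
  shows "proj_pt v \<in> quadric Q \<longleftrightarrow> Q v = 0"
proof
  assume "proj_pt v \<in> quadric Q"
  then obtain w where "proj_pt v = proj_pt w" "Q w = 0" by (auto simp: quadric_def)
  then show "Q v = 0" using assms by (auto simp: proj_pt_eq_iff)
qed (use assms(1) in \<open>auto simp: quadric_def\<close>)

section \<open>Two facts on finite fields\<close>

lemma power_card_eq_self:
  fixes x :: "'a::{field,finite}"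
  shows "x ^ CARD('a) = x"
proof (cases "x = 0")
  case False
  let ?U = "UNIV - {0 :: 'a}"
  \<comment> \<open>Multiplication by \<open>x\<close> permutes the nonzero elements, so their
    product is unchanged when each factor is multiplied by \<open>x\<close>; cancelling it gives
    \<open>x ^ card ?U = 1\<close>.\<close>
  have "bij_betw ((*) x) ?U ?U"
    by (rule bij_betw_byWitness[where f' = "\<lambda>y. y / x"]) (use False in auto)
  then have "\<Prod>?U = (\<Prod>y\<in>?U. x * y)"
    by (rule prod.reindex_bij_betw[symmetric])
  also have "\<dots> = x ^ card ?U * \<Prod>?U"
    by (simp only: prod.distrib prod_constant)
  finally have "x ^ card ?U = 1"
    by (simp del: card_Diff_singleton card_Diff_insert)
  moreover have "CARD('a) = Suc (card ?U)"
    by (rule card.remove) auto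
  ultimately show ?thesis by (simp only: power_Suc mult_1_right)
next
  case True
  then show ?thesis by (metis power_0_left zero_less_card_finite neq0_conv)
qed

text \<open>The translation by 1 permutes the field, so the sum of all elements does not change when
  1 is added to each. This is the source of characteristic 2 below.\<close>

lemma of_nat_card_eq_0: "of_nat CARD('a) = (0 :: 'a::{field,finite})"
proof -
  have "(\<Sum>x\<in>UNIV. x + 1) = (\<Sum>x\<in>UNIV. x :: 'a)"
    by (rule sum.reindex_bij_betw[where h = "\<lambda>x. x + 1"])
       (rule bij_betw_byWitness[where f' = "\<lambda>y. y - 1"], auto)
  then show ?thesis by (simp add: sum.distrib)
qed

section \<open>The quadratic form of the cone: affine zeros, vertex and base\<close>

lemma cone_form_hom7 [simp]:
  "cone_form \<delta> a0 a1 b1 (hom7 x0 x1 x2 x3 x4 x5 x6) =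
     x0 * x6 + a0 * (x2\<^sup>2 + x4\<^sup>2)
     + a1 * (x1\<^sup>2 + x2\<^sup>2 + \<delta> * x2\<^sup>2 + x3\<^sup>2 + x4\<^sup>2 + \<delta> * x4\<^sup>2)
     + b1 * (x1\<^sup>2 + \<delta> * x2\<^sup>2 + x1 * x2 + x3\<^sup>2 + \<delta> * x4\<^sup>2 + x3 * x4)"
  by (simp add: cone_form_def)

lemma cone_form_scale: "cone_form \<delta> a0 a1 b1 (c *s v) = c\<^sup>2 * cone_form \<delta> a0 a1 b1 v"
  by (simp add: cone_form_def algebra_simps power2_eq_square)

lemma proj_pt_in_cone_form_quadric:
  "v \<noteq> 0 \<Longrightarrow> proj_pt v \<in> quadric (cone_form \<delta> a0 a1 b1) \<longleftrightarrow> cone_form \<delta> a0 a1 b1 v = 0"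
  by (rule proj_pt_in_quadric) (auto simp: cone_form_scale)

text \<open>A point off the hyperplane at infinity can be scaled to leading coordinate 1, and
  scaling preserves the zeros of the form.\<close>

lemma affine_part_cone_form_quadric:
  "affine_part (quadric (cone_form \<delta> a0 a1 b1)) =
     {proj_pt (hom7 1 x1 x2 x3 x4 x5 x6) | x1 x2 x3 x4 x5 x6.
        cone_form \<delta> a0 a1 b1 (hom7 1 x1 x2 x3 x4 x5 x6) = 0}" (is "?L = ?R")
proof
  show "?L \<subseteq> ?R"
  proof
    fix P assume "P \<in> ?L"
    then obtain v where v: "P = proj_pt v" "v \<noteq> 0" "cone_form \<delta> a0 a1 b1 v = 0" "v $ 0 \<noteq> 0"
      unfolding affine_part_def quadric_def mem_Collect_eq
      using proj_pt_subset_hyperplane_inf by metis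
    define c where "c = inverse (v $ 0)"
    have "P = proj_pt (c *s v)" "cone_form \<delta> a0 a1 b1 (c *s v) = 0"
      using v by (simp_all add: c_def proj_pt_scale cone_form_scale)
    moreover have "(c *s v) $ 0 = 1" using v(4) by (simp add: c_def)
    ultimately show "P \<in> ?R" using hom7_eta[of "c *s v"] by (metis (mono_tags, lifting) mem_Collect_eq)
  qed
  show "?R \<subseteq> ?L"
  proof
    fix P assume "P \<in> ?R"
    then obtain x1 x2 x3 x4 x5 x6 where P: "P = proj_pt (hom7 1 x1 x2 x3 x4 x5 x6)"
      "cone_form \<delta> a0 a1 b1 (hom7 1 x1 x2 x3 x4 x5 x6) = 0" by blast
    then have "P \<in> quadric (cone_form \<delta> a0 a1 b1)"
      by (subst P(1), subst proj_pt_in_cone_form_quadric) auto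
    then show "P \<in> ?L" using P(1) by (simp add: affine_part_def proj_pt_subset_hyperplane_inf)
  qed
qed

text \<open>In characteristic 2 squaring is additive, so all square terms cancel and only the mixed
  products \<open>x\<^sub>0x\<^sub>6\<close>, \<open>x\<^sub>1x\<^sub>2\<close> and
  \<open>x\<^sub>3x\<^sub>4\<close> contribute.\<close>

lemma cone_form_polar:
  assumes "(1::'a::field) + 1 = 0"
  shows "cone_form \<delta> a0 a1 b1 (hom7 x0 x1 x2 x3 x4 x5 x6 + hom7 y0 y1 y2 y3 y4 y5 y6)
       - cone_form \<delta> a0 a1 b1 (hom7 x0 x1 x2 x3 x4 x5 x6)
       - cone_form \<delta> a0 a1 b1 (hom7 y0 y1 y2 y3 y4 y5 y6)
     = x0 * y6 + x6 * y0 + b1 * (x1 * y2 + x2 * y1 + x3 * y4 + x4 * (y3 :: 'a))"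
proof -
  have "(2 :: 'a) = 0" using assms by simp
  then have "(x + y)\<^sup>2 = x\<^sup>2 + y\<^sup>2" for x y :: 'a by (simp add: power2_sum)
  then show ?thesis by (simp add: algebra_simps)
qed

text \<open>Pairing with the unit vectors under the polar form isolates each coordinate except
  \<open>x\<^sub>5\<close>, up to the nonzero factor \<open>b1\<close>. Hence the radical is spanned
  by the unit vector of \<open>x\<^sub>5\<close>, where the form itself also vanishes.\<close>

lemma singular_points_cone_form:
  assumes char2: "(1::'a::field) + 1 = 0" and b1: "b1 \<noteq> (0::'a)"
  shows "singular_points (cone_form \<delta> a0 a1 b1) = {proj_pt (hom7 0 0 0 0 0 1 0)}" (is "?S = {?V}")
proof
  show "?S \<subseteq> {?V}"
  proof
    fix P assume "P \<in> ?S"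
    then obtain v where v: "P = proj_pt v" "v \<noteq> 0"
      and pol: "\<And>w. cone_form \<delta> a0 a1 b1 (v + w) - cone_form \<delta> a0 a1 b1 v - cone_form \<delta> a0 a1 b1 w = 0"
      by (auto simp: singular_points_def)
    obtain x0 x1 x2 x3 x4 x5 x6 where x: "v = hom7 x0 x1 x2 x3 x4 x5 x6" by (rule hom7_cases)
    have *: "x0 * y6 + x6 * y0 + b1 * (x1 * y2 + x2 * y1 + x3 * y4 + x4 * y3) = 0" for y0 y1 y2 y3 y4 y6
      using pol[of "hom7 y0 y1 y2 y3 y4 0 y6"] unfolding x cone_form_polar[OF char2] .
    have "x0 = 0" "x6 = 0" "x1 = 0" "x2 = 0" "x3 = 0" "x4 = 0"
      using *[of 1 0 0 0 0 0] *[of 0 0 0 0 0 1] *[of 0 1 0 0 0 0] *[of 0 0 1 0 0 0]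
        *[of 0 0 0 1 0 0] *[of 0 0 0 0 1 0] b1 by simp_all
    then show "P \<in> {?V}" using v x by (auto simp: proj_pt_eq_iff)
  qed
  have "cone_form \<delta> a0 a1 b1 (hom7 0 0 0 0 0 1 0 + w) - cone_form \<delta> a0 a1 b1 (hom7 0 0 0 0 0 1 0)
      - cone_form \<delta> a0 a1 b1 w = 0" for w
    by (cases w rule: hom7_cases) (simp only: cone_form_polar[OF char2], simp)
  then show "{?V} \<subseteq> ?S" unfolding singular_points_def
    by (auto intro!: exI[of _ "hom7 0 0 0 0 0 1 0"])
qed

lemma base_incl_hom6 [simp]: "base_incl (hom6 x0 x1 x2 x3 x4 x5) = hom7 x0 x1 x2 x3 x4 0 x5"
  by (simp add: base_incl_def)

lemma base_incl_scale: "base_incl (c *s y) = c *s base_incl y"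
  by (simp add: base_incl_def)

text \<open>The form does not involve \<open>x\<^sub>5\<close>. A vector is a multiple of the vertex
  vector plus a vector with \<open>x\<^sub>5 = 0\<close>, and the form has the same value at both
  the sum and the second summand.\<close>

lemma quadric_cone_form_eq_cone:
  "quadric (cone_form \<delta> a0 a1 b1) =
     cone_over (proj_pt (hom7 0 0 0 0 0 1 0)) ((\<lambda>P. base_incl ` P) ` quadric (cone_form \<delta> a0 a1 b1 \<circ> base_incl))"
  (is "?B = cone_over ?V ?T")
proof
  let ?Q = "cone_form \<delta> a0 a1 b1" and ?e = "hom7 0 0 0 0 0 1 0"
  show "?B \<subseteq> cone_over ?V ?T"
  proof
    fix P assume "P \<in> ?B"
    then obtain v where v: "P = proj_pt v" "v \<noteq> 0" "?Q v = 0" by (auto simp: quadric_def)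
    obtain x0 x1 x2 x3 x4 x5 x6 where x: "v = hom7 x0 x1 x2 x3 x4 x5 x6" by (rule hom7_cases)
    define y where "y = hom6 x0 x1 x2 x3 x4 x6"
    have dec: "v = x5 *s ?e + base_incl y" by (simp add: x y_def)
    show "P \<in> cone_over ?V ?T"
    proof (cases "base_incl y = 0")
      \<comment> \<open>The projection from the vertex is undefined here: there is no base point to
        use, and \<open>P\<close> is the vertex itself.\<close>
      case True
      then have "P = ?V" using v dec by (auto simp: proj_pt_eq_iff simp del: scale_hom7)
      then show ?thesis by (simp add: cone_over_def)
    next
      case False
      then have "y \<noteq> 0" by (auto simp: base_incl_def)
      moreover have "?Q (base_incl y) = 0" using v(3) by (simp add: x y_def)
      ultimately have T: "base_incl ` proj_pt y \<in> ?T" by (auto simp: quadric_def)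
      let ?W = "vec.span (?V \<union> base_incl ` proj_pt y)"
      have "?e \<in> ?W" "base_incl y \<in> ?W"
        by (auto intro!: vec.span_base simp: proj_pt_self)
      then have "v \<in> ?W" unfolding dec by (intro vec.span_add vec.span_scale)
      then have "P \<in> points_of ?W"
        using v by (auto simp: points_of_def PG_points_def proj_pt_subset_iff)
      then show ?thesis using T by (auto simp: cone_over_def)
    qed
  qed
  show "cone_over ?V ?T \<subseteq> ?B"
  proof
    fix P assume "P \<in> cone_over ?V ?T"
    then consider "P = ?V"
      | y where "y \<noteq> 0" "?Q (base_incl y) = 0" "P \<in> points_of (vec.span (?V \<union> base_incl ` proj_pt y))"
      by (auto simp: cone_over_def quadric_def)
    then show "P \<in> ?B"
    proof cases
      case 1
      then show ?thesis by (simp add: proj_pt_in_cone_form_quadric)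
    next
      case 2
      \<comment> \<open>The explicit combinations of the two generators contain the span, and on
        them the form is the square of the second coefficient times its value at the base
        point.\<close>
      let ?W = "{c *s ?e + t *s base_incl y | c t. True}"
      have sub: "vec.subspace ?W"
      proof (rule vec.subspaceI)
        have "0 = 0 *s ?e + 0 *s base_incl y" by (simp only: vec.scale_zero_left add_0)
        then show "0 \<in> ?W" by blast
      next
        fix v w assume "v \<in> ?W" "w \<in> ?W"
        then obtain c t c' t' where "v = c *s ?e + t *s base_incl y" "w = c' *s ?e + t' *s base_incl y" by blast
        then have "v + w = (c + c') *s ?e + (t + t') *s base_incl y"
          by (simp only: vec.scale_left_distrib ac_simps)
        then show "v + w \<in> ?W" by blast
      next
        fix k v assume "v \<in> ?W"
        then obtain c t where "v = c *s ?e + t *s base_incl y" by blast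
        then have "k *s v = (k * c) *s ?e + (k * t) *s base_incl y"
          by (simp only: vec.scale_right_distrib vec.scale_scale)
        then show "k *s v \<in> ?W" by blast
      qed
      have mem: "c *s ?e = c *s ?e + 0 *s base_incl y" "c *s base_incl y = 0 *s ?e + c *s base_incl y" for c
        by (simp_all only: vec.scale_zero_left add_0 add_0_right)
      have "?V \<union> base_incl ` proj_pt y \<subseteq> ?W"
        by (auto simp: mem_proj_pt base_incl_scale simp del: scale_hom7) (use mem in \<open>blast+\<close>)
      then have "vec.span (?V \<union> base_incl ` proj_pt y) \<subseteq> ?W"
        using sub by (rule vec.span_minimal)
      with 2(3) obtain v where v: "v \<noteq> 0" "P = proj_pt v" "v \<in> ?W"
        unfolding points_of_def PG_points_def using proj_pt_self by blast
      then obtain c t where "v = c *s ?e + t *s base_incl y" by blast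
      then have "?Q v = t\<^sup>2 * ?Q (base_incl y)"
        by (simp add: cone_form_def base_incl_def algebra_simps power2_eq_square)
      then show ?thesis using 2(2) v by (simp add: proj_pt_in_cone_form_quadric)
    qed
  qed
qed

lemma hyperbolic_quadric5_base:
  assumes char2: "(1::'a::field) + 1 = 0" and b1: "b1 \<noteq> (0::'a)"
  shows "hyperbolic_quadric5 (quadric (cone_form \<delta> a0 a1 b1 \<circ> base_incl))"
proof -
  \<comment> \<open>With u = x1 + x3 and v = x2 + x4, these are the coefficients of the squares of u
    and v. The rest, apart from \<open>x\<^sub>0x\<^sub>6\<close>, is \<open>b1\<close> times x1 x2
    + x3 x4 = u x2 + v x1 + u v.\<close>
  define \<alpha> where "\<alpha> = a1 + b1"
  define \<gamma> where "\<gamma> = a0 + a1 + (a1 + b1) * \<delta>"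
  \<comment> \<open>Consecutive pairs of components are the factors of the three products in the
    canonical form.\<close>
  define f :: "'a^6 \<Rightarrow> 'a^6" where
    "f y = hom6 (y $ 0) (y $ 5) (y $ 1 + y $ 3) (\<alpha> * (y $ 1 + y $ 3) + b1 * y $ 2)
       (y $ 2 + y $ 4) (\<gamma> * (y $ 2 + y $ 4) + b1 * (y $ 1 + y $ 3) + b1 * y $ 1)" for y
  have lin: "Vector_Spaces.linear (*s) (*s) f"
    by (auto simp: Vector_Spaces.linear_iff vec.vector_space_axioms f_def vec_eq_iff forall_6 algebra_simps)
  have mat: "matrix f *v y = f y" for y
    using lin by (rule matrix_works)
  \<comment> \<open>Components 3 and 5 give \<open>y $ 2\<close> and \<open>y $ 1\<close> after
    division by \<open>b1\<close>; then components 2 and 4 give \<open>y $ 3\<close> and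
    \<open>y $ 4\<close>. An injective square matrix is invertible.\<close>
  have "x = y" if "f x = f y" for x y
    using that b1 by (auto simp: f_def vec_eq_iff forall_6)
  then have "inj ((*v) (matrix f))" by (auto simp: inj_def mat)
  then have "invertible (matrix f)"
    by (metis invertible_left_inverse matrix_left_invertible_injective)
  moreover have "cone_form \<delta> a0 a1 b1 (base_incl y) = hyperbolic_form5 (matrix f *v y)" for y
  proof -
    have dbl: "z + z = 0" for z :: 'a
      using char2 by (metis distrib_left mult.right_neutral mult_zero_right)
    \<comment> \<open>The companion of \<open>dbl\<close> for equal summands that are followed by
      further ones in a sorted sum; the two together normalise sums in characteristic 2.\<close>
    then have dbl': "z + (z + w) = w" for z w :: 'a
      by (metis add.assoc add_0)
    show ?thesis
      by (simp add: mat f_def base_incl_def hyperbolic_form5_def \<alpha>_def \<gamma>_def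
          algebra_simps power2_eq_square dbl dbl')
  qed
  ultimately show ?thesis unfolding hyperbolic_quadric5_def comp_def by auto
qed

section \<open>The quadratic extension: coordinates, conjugation and norm\<close>

locale quadratic_extension =
  fixes \<iota> :: "'f::{field,finite} \<Rightarrow> 'g::{field,finite}"
    and \<epsilon> :: 'g and \<delta> :: 'f and h :: nat
  assumes emb: "field_embedding \<iota>"
    and card_g: "CARD('g) = CARD('f)\<^sup>2"
    and card_f: "CARD('f) = 2 ^ h"
    and trace: "abs_trace2 h \<delta> = 1"
    and eps: "\<epsilon> \<notin> range \<iota>" "\<epsilon>\<^sup>2 + \<epsilon> + \<iota> \<delta> = 0"
begin

lemma iota_add [simp]: "\<iota> (x + y) = \<iota> x + \<iota> y"
  and iota_mult [simp]: "\<iota> (x * y) = \<iota> x * \<iota> y"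
  and iota_1 [simp]: "\<iota> 1 = 1"
  using emb by (auto simp: field_embedding_def)

lemma iota_0 [simp]: "\<iota> 0 = 0"
  by (metis add_cancel_right_left iota_add)

lemma iota_power [simp]: "\<iota> (x ^ n) = \<iota> x ^ n"
  by (induction n) auto

lemma iota_eq_0 [simp]: "\<iota> x = 0 \<longleftrightarrow> x = 0"
proof
  assume "\<iota> x = 0"
  then have "\<iota> (x * inverse x) = 0" by simp
  then show "x = 0" by (metis iota_1 right_inverse zero_neq_one)
qed simp

text \<open>The number of elements, \<open>2 ^ h\<close>, is zero in the field, and a field has no
  nonzero nilpotent elements.\<close>

lemma char2_f: "(1 :: 'f) + 1 = 0"
proof -
  have "(2 :: 'f) ^ h = 0"
    using of_nat_card_eq_0[where 'a = 'f] by (simp add: card_f)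
  then show ?thesis by simp
qed

lemma double_f: "x + x = 0" for x :: 'f
  using char2_f by (metis distrib_left mult.right_neutral mult_zero_right)

lemma double_g: "z + z = 0" for z :: 'g
proof -
  have "(1 :: 'g) + 1 = 0" using iota_add[of 1 1] by (simp only: char2_f iota_1 iota_0)
  then show ?thesis by (metis distrib_left mult.right_neutral mult_zero_right)
qed

lemma cancel_f: "x + (x + y) = y" for x y :: 'f
  by (metis add.assoc add_0 double_f)

lemma cancel_g: "x + (x + y) = y" for x y :: 'g
  by (metis add.assoc add_0 double_g)

lemma minus_g: "- x = x" for x :: 'g
  by (rule minus_unique) (rule double_g)

lemma diff_g: "x - y = x + y" for x y :: 'g
  using minus_g[of y] by (metis diff_conv_add_uminus)

lemma add_eq_0_g: "x + y = 0 \<longleftrightarrow> x = y" for x y :: 'g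
  using diff_g[of x y] by (metis eq_iff_diff_eq_0)

lemma square_add_g: "(x + y)\<^sup>2 = x\<^sup>2 + y\<^sup>2" for x y :: 'g
  by (simp add: power2_eq_square algebra_simps double_g cancel_g)

lemma frobenius_add: "(x + y) ^ 2 ^ n = x ^ 2 ^ n + y ^ 2 ^ n" for x y :: 'g
  by (induction n) (simp_all add: power_mult square_add_g mult.commute[of 2])

lemma eps_square: "\<epsilon> * \<epsilon> = \<epsilon> + \<iota> \<delta>"
  using eps(2) by (simp add: power2_eq_square add.assoc add_eq_0_g)

lemma eps_power_card: "\<epsilon> ^ CARD('f) = \<epsilon> + 1"
proof -
  \<comment> \<open>The induction runs over partial sums of the trace; only the full sum, at
    \<open>n = h\<close>, is known to be 1.\<close>
  have "\<epsilon> ^ 2 ^ n = \<epsilon> + \<iota> (\<Sum>i<n. \<delta> ^ 2 ^ i)" for n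
  proof (induction n)
    case (Suc n)
    have "\<epsilon> ^ 2 ^ Suc n = (\<epsilon> ^ 2) ^ 2 ^ n"
      by (simp add: power_mult)
    also have "\<dots> = \<epsilon> ^ 2 ^ n + \<iota> \<delta> ^ 2 ^ n"
      by (simp only: power2_eq_square eps_square frobenius_add)
    finally show ?case using Suc by (simp add: add.assoc)
  qed simp
  from this[of h] show ?thesis
    using trace by (simp add: card_f abs_trace2_def)
qed

definition elt :: "'f \<Rightarrow> 'f \<Rightarrow> 'g" where
  "elt x y = \<iota> x + \<epsilon> * \<iota> y"

text \<open>Linear independence of 1 and \<epsilon>: a relation with \<open>y\<close> nonzero could
  be solved for \<epsilon>, placing it in the subfield.\<close>

lemma elt_eq_0: "elt x y = 0 \<longleftrightarrow> x = 0 \<and> y = 0"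
proof
  assume *: "elt x y = 0"
  have "y = 0"
  proof (rule ccontr)
    assume y: "y \<noteq> 0"
    have "\<epsilon> * \<iota> y = \<iota> x" using * by (simp add: elt_def add_eq_0_g)
    then have "\<epsilon> * \<iota> (y * inverse y) = \<iota> (x * inverse y)"
      unfolding iota_mult by (simp only: mult.assoc[symmetric])
    then have "\<epsilon> = \<iota> (x * inverse y)" using y by (metis iota_1 mult.right_neutral right_inverse)
    then show False using eps(1) by blast
  qed
  with * show "x = 0 \<and> y = 0" by (simp add: elt_def)
qed (simp add: elt_def)

lemma elt_add: "elt x y + elt x' y' = elt (x + x') (y + y')"
  by (simp add: elt_def algebra_simps)

lemma elt_inject [simp]: "elt x y = elt x' y' \<longleftrightarrow> x = x' \<and> y = y'"
proof
  assume "elt x y = elt x' y'"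
  then have "elt x y + elt x' y' = 0" by (simp only: add_eq_0_g)
  then have "elt (x + x') (y + y') = 0" by (simp only: elt_add)
  then have "x + x' = 0" "y + y' = 0" by (auto simp: elt_eq_0)
  then show "x = x' \<and> y = y'" using cancel_f by (metis add.right_neutral)
qed simp

text \<open>Surjectivity is by counting: there are as many coordinate pairs as elements of the large
  field.\<close>

lemma bij_elt: "bij (\<lambda>(x, y). elt x y)"
proof -
  have inj: "inj (\<lambda>(x, y). elt x y)" by (auto simp: inj_on_def)
  have "card (range (\<lambda>(x, y). elt x y)) = CARD('g)"
    using card_image[OF inj] by (simp add: card_g power2_eq_square)
  then have "range (\<lambda>(x, y). elt x y) = UNIV"
    by (intro card_subset_eq) auto
  with inj show ?thesis by (simp add: bij_def)
qed

definition re :: "'g \<Rightarrow> 'f" where "re z = fst (inv (\<lambda>(x, y). elt x y) z)"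
definition im :: "'g \<Rightarrow> 'f" where "im z = snd (inv (\<lambda>(x, y). elt x y) z)"

lemma elt_re_im: "elt (re z) (im z) = z"
  using surj_f_inv_f[OF bij_is_surj[OF bij_elt], of z] by (simp add: re_def im_def case_prod_beta)

lemma re_elt [simp]: "re (elt x y) = x" and im_elt [simp]: "im (elt x y) = y"
  using elt_re_im[of "elt x y"] by (auto simp only: elt_inject)

lemma elt_cases: obtains x y where "z = elt x y"
  using elt_re_im by metis

lemma re_add [simp]: "re (z + z') = re z + re z'"
  by (cases z rule: elt_cases; cases z' rule: elt_cases) (simp add: elt_add)

lemma im_add [simp]: "im (z + z') = im z + im z'"
  by (cases z rule: elt_cases; cases z' rule: elt_cases) (simp add: elt_add)

lemma elt_0_right: "elt c 0 = \<iota> c"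
  by (simp add: elt_def)

lemma re_iota [simp]: "re (\<iota> c) = c" and im_iota [simp]: "im (\<iota> c) = 0"
  by (simp_all flip: elt_0_right)

lemma re_0 [simp]: "re 0 = 0" and im_0 [simp]: "im 0 = 0"
  using re_iota[of 0] im_iota[of 0] by simp_all

lemma eq_iff_re_im: "z = z' \<longleftrightarrow> re z = re z' \<and> im z = im z'"
  by (metis elt_re_im)

lemma elt_mult: "elt x y * elt x' y' = elt (x * x' + \<delta> * y * y') (x * y' + x' * y + y * y')"
proof -
  have eps_left: "\<epsilon> * (\<epsilon> * z) = \<epsilon> * z + \<iota> \<delta> * z" for z
    by (simp add: mult.assoc[symmetric] eps_square distrib_right)
  show ?thesis by (simp add: elt_def algebra_simps eps_left)
qed

lemma re_iota_mult [simp]: "re (\<iota> c * z) = c * re z" and im_iota_mult [simp]: "im (\<iota> c * z) = c * im z"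
  by (cases z rule: elt_cases, simp add: elt_mult flip: elt_0_right)+

lemma in_range_iota: "z \<in> range \<iota> \<longleftrightarrow> im z = 0"
proof
  assume "im z = 0"
  then have "z = \<iota> (re z)" by (simp add: eq_iff_re_im)
  then show "z \<in> range \<iota>" by blast
qed auto

text \<open>This power map is the conjugation of the extension: it is additive, fixes the subfield
  and sends \<epsilon> to \<open>\<epsilon> + 1\<close>.\<close>

lemma elt_power_card: "elt x y ^ CARD('f) = elt (x + y) y"
proof -
  have "\<iota> z ^ CARD('f) = \<iota> z" for z
    using power_card_eq_self[of z] by (metis iota_power)
  then have "elt x y ^ CARD('f) = \<iota> x + (\<epsilon> + 1) * \<iota> y"
    using frobenius_add[of "\<iota> x" "\<epsilon> * \<iota> y" h]
    by (simp add: elt_def power_mult_distrib eps_power_card flip: card_f)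
  then show ?thesis by (simp add: elt_def algebra_simps)
qed

lemma elt_norm: "elt x y ^ (CARD('f) + 1) = \<iota> (x\<^sup>2 + x * y + \<delta> * y\<^sup>2)"
proof -
  have "elt x y ^ (CARD('f) + 1) = elt x y * elt (x + y) y"
    by (simp only: power_add power_one_right elt_power_card mult.commute)
  also have "\<dots> = elt (x\<^sup>2 + x * y + \<delta> * y\<^sup>2) 0"
    by (simp add: elt_mult power2_eq_square algebra_simps double_f cancel_f)
  finally show ?thesis by (simp add: elt_0_right)
qed

text \<open>Norms lie in the subfield, so the term with \<open>b\<close> contributes
  \<open>b1\<close> times the norms to the \<epsilon>-coordinate; the other terms come from the
  square of \<open>elt u v\<close>. Used with \<open>x0 = 1\<close> for affine points and with
  \<open>x0 = 0\<close> for the lines at infinity.\<close>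

lemma cone_form_re_im:
  assumes "a = elt a0 a1" "b = elt b0 b1"
  shows "cone_form \<delta> a0 a1 b1 (hom7 x0 (re x) (im x) (re y) (im y) x5 x6) =
     x0 * x6 + im (a * (x\<^sup>2 + y\<^sup>2) - b * (x ^ (CARD('f) + 1) + y ^ (CARD('f) + 1)))"
proof -
  obtain x1 x2 where x: "x = elt x1 x2" by (rule elt_cases)
  obtain x3 x4 where y: "y = elt x3 x4" by (rule elt_cases)
  have sq: "(elt u v)\<^sup>2 = elt (u\<^sup>2 + \<delta> * v\<^sup>2) (v\<^sup>2)" for u v
    by (simp add: power2_eq_square elt_mult mult.commute mult.left_commute double_f cancel_f flip: mult_2)
  have im: "im (elt c d * \<iota> t) = d * t" for c d t
    by (simp add: mult.commute)
  show ?thesis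
    unfolding x y elt_norm assms sq diff_g
    by (simp add: im elt_add elt_mult flip: iota_add) (simp add: algebra_simps)
qed

text \<open>Squaring is additive with trivial kernel, hence injective, and the field is
  finite.\<close>

lemma square_bij: "bij (\<lambda>z :: 'g. z\<^sup>2)"
proof -
  have "inj (\<lambda>z :: 'g. z\<^sup>2)"
  proof (rule injI)
    fix x y :: 'g assume "x\<^sup>2 = y\<^sup>2"
    then have "(x + y)\<^sup>2 = 0" by (simp add: square_add_g double_g)
    then show "x = y" by (simp add: add_eq_0_g)
  qed
  then show ?thesis by (simp add: bij_def finite_UNIV_inj_surj)
qed

text \<open>Each fibre consists of roots of a polynomial of degree q + 1, so it has at most q + 1
  elements. The q - 1 fibres over nonzero values partition the (q - 1)(q + 1) nonzero elements, so
  the bound is attained in every fibre.\<close>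

lemma card_norm_fibre:
  assumes "c \<noteq> 0"
  shows "card {z :: 'g. z ^ (CARD('f) + 1) = \<iota> c} = CARD('f) + 1"
proof -
  let ?q = "CARD('f)"
  let ?A = "\<lambda>c. {z :: 'g. z ^ (?q + 1) = \<iota> c}"
  have le: "card (?A c) \<le> ?q + 1" for c
  proof -
    let ?p = "monom 1 (?q + 1) + [:- \<iota> c:]"
    have deg: "degree ?p = ?q + 1"
      by (subst degree_add_eq_left) (auto simp: degree_monom_eq)
    then have "?p \<noteq> 0" by auto
    from card_poly_roots_bound[OF this] show ?thesis
      by (simp only: deg) (simp add: poly_monom)
  qed
  \<comment> \<open>Needed for the truncated subtractions of natural numbers in the count.\<close>
  have q: "?q \<ge> 1" by (simp add: Suc_leI)
  have "(\<Sum>c\<in>UNIV - {0}. card (?A c)) = card (\<Union>c\<in>UNIV - {0}. ?A c)"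
    by (rule card_UN_disjoint[symmetric]) (auto simp: inj_eq elt_0_right[symmetric])
  also have "(\<Union>c\<in>UNIV - {0}. ?A c) = UNIV - {0}"
  proof -
    have "z \<in> (\<Union>c\<in>UNIV - {0}. ?A c)" if "z \<noteq> 0" for z
    proof -
      obtain c where c: "z ^ (?q + 1) = \<iota> c" using elt_norm elt_re_im by metis
      moreover have "z ^ (?q + 1) \<noteq> 0" using that by simp
      ultimately have "c \<noteq> 0" by auto
      with c show ?thesis by blast
    qed
    then show ?thesis by auto
  qed
  also have "card \<dots> = ?q\<^sup>2 - 1" by (simp add: card_g)
  also have "\<dots> = (\<Sum>c\<in>UNIV - {0 :: 'f}. ?q + 1)"
    using q by (simp add: card_Diff_singleton power2_eq_square algebra_simps diff_mult_distrib)
  finally show ?thesis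
    by (rule sum_mono_inv) (use assms le in auto)
qed

section \<open>Affine points in the Barlotti--Cofman representation\<close>

lemma bc_affine_proj_pt:
  "bc_affine \<iota> \<epsilon> (proj_pt (hom4 1 x y z)) = proj_pt (hom7 1 (re x) (im x) (re y) (im y) (re z) (im z))"
  unfolding bc_affine_def elt_def[symmetric]
proof (rule the_equality)
  show "\<exists>x1 x2 x3 x4 x5 x6. proj_pt (hom4 1 x y z) = proj_pt (hom4 1 (elt x1 x2) (elt x3 x4) (elt x5 x6)) \<and>
      proj_pt (hom7 1 (re x) (im x) (re y) (im y) (re z) (im z)) = proj_pt (hom7 1 x1 x2 x3 x4 x5 x6)"
    by (rule exI[of _ "re x"], rule exI[of _ "im x"], rule exI[of _ "re y"], rule exI[of _ "im y"],
        rule exI[of _ "re z"], rule exI[of _ "im z"]) (simp add: elt_re_im)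
\<comment> \<open>Uniqueness: the leading coordinate 1 fixes the scalar, and \<open>elt\<close> is
  injective.\<close>
qed (auto simp: proj_pt_eq_iff)

lemma affine_part_BM:
  "affine_part (BM_variety \<iota> a b) =
     {proj_pt (hom4 1 x y z) | x y z.
        im (z + a * (x\<^sup>2 + y\<^sup>2) - b * (x ^ (CARD('f) + 1) + y ^ (CARD('f) + 1))) = 0}"
  unfolding affine_part_def BM_variety_def in_range_iota
  using hom4_affine_not_at_infinity BM_infinity_at_infinity by blast

lemma infinite_part_BM: "infinite_part (BM_variety \<iota> a b) = BM_infinity CARD('f)"
  unfolding infinite_part_def BM_variety_def
  using hom4_affine_not_at_infinity BM_infinity_at_infinity by blast

lemma bij_betw_affine_parts:
  assumes "a = elt a0 a1" "b = elt b0 b1"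
  shows "bij_betw (bc_affine \<iota> \<epsilon>) (affine_part (BM_variety \<iota> a b))
           (affine_part (quadric (cone_form \<delta> a0 a1 b1)))"
proof -
  \<comment> \<open>Here \<open>x0 = 1\<close> and \<open>x6 = im z\<close>, so the product
    \<open>x\<^sub>0x\<^sub>6\<close> supplies the contribution of \<open>z\<close>.\<close>
  have eq: "cone_form \<delta> a0 a1 b1 (hom7 1 (re x) (im x) (re y) (im y) (re z) (im z)) =
      im (z + a * (x\<^sup>2 + y\<^sup>2) - b * (x ^ (CARD('f) + 1) + y ^ (CARD('f) + 1)))" for x y z
    unfolding cone_form_re_im[OF assms] by (simp only: diff_conv_add_uminus add.assoc im_add mult_1)
  show ?thesis
    unfolding bij_betw_def
  proof
    show "inj_on (bc_affine \<iota> \<epsilon>) (affine_part (BM_variety \<iota> a b))"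
      unfolding affine_part_BM
    proof (rule inj_onI, elim CollectE exE conjE)
      fix P P' x y z x' y' z'
      assume P: "P = proj_pt (hom4 1 x y z)" "P' = proj_pt (hom4 1 x' y' z')"
        and eq: "bc_affine \<iota> \<epsilon> P = bc_affine \<iota> \<epsilon> P'"
      have "x = x' \<and> y = y' \<and> z = z'"
        using eq unfolding P bc_affine_proj_pt proj_pt_hom7_affine by (simp add: eq_iff_re_im)
      then show "P = P'" by (simp only: P)
    qed
    show "bc_affine \<iota> \<epsilon> ` affine_part (BM_variety \<iota> a b) = affine_part (quadric (cone_form \<delta> a0 a1 b1))"
      (is "_ ` ?L = ?R")
    proof
      show "bc_affine \<iota> \<epsilon> ` ?L \<subseteq> ?R"
      proof
        fix P assume "P \<in> bc_affine \<iota> \<epsilon> ` ?L"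
        then obtain x y z where P: "P = bc_affine \<iota> \<epsilon> (proj_pt (hom4 1 x y z))"
          "im (z + a * (x\<^sup>2 + y\<^sup>2) - b * (x ^ (CARD('f) + 1) + y ^ (CARD('f) + 1))) = 0"
          unfolding affine_part_BM by blast
        then show "P \<in> ?R"
          unfolding affine_part_cone_form_quadric bc_affine_proj_pt using eq by (metis (mono_tags, lifting) mem_Collect_eq)
      qed
      show "?R \<subseteq> bc_affine \<iota> \<epsilon> ` ?L"
      proof
        fix P assume "P \<in> ?R"
        then obtain x1 x2 x3 x4 x5 x6 where P: "P = proj_pt (hom7 1 x1 x2 x3 x4 x5 x6)"
          "cone_form \<delta> a0 a1 b1 (hom7 1 x1 x2 x3 x4 x5 x6) = 0"
          unfolding affine_part_cone_form_quadric by blast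
        let ?x = "elt x1 x2" and ?y = "elt x3 x4" and ?z = "elt x5 x6"
        have "im (?z + a * (?x\<^sup>2 + ?y\<^sup>2) - b * (?x ^ (CARD('f) + 1) + ?y ^ (CARD('f) + 1))) = 0"
          using P(2) eq[of ?x ?y ?z] by (simp only: re_elt im_elt)
        then have "proj_pt (hom4 1 ?x ?y ?z) \<in> ?L" unfolding affine_part_BM by blast
        moreover have "P = bc_affine \<iota> \<epsilon> (proj_pt (hom4 1 ?x ?y ?z))"
          by (simp add: P bc_affine_proj_pt)
        ultimately show "P \<in> bc_affine \<iota> \<epsilon> ` ?L" by blast
      qed
    qed
  qed
qed

section \<open>Lines of the spread, by restriction of scalars to the subfield\<close>

definition subfield_vec :: "'g \<Rightarrow> 'g \<Rightarrow> 'g \<Rightarrow> 'f^7" where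
  "subfield_vec u v w = hom7 0 (re u) (im u) (re v) (im v) (re w) (im w)"

lemma subfield_vec_inject: "subfield_vec u v w = subfield_vec u' v' w' \<longleftrightarrow> u = u' \<and> v = v' \<and> w = w'"
  by (auto simp: subfield_vec_def eq_iff_re_im)

lemma subfield_vec_eq_0: "subfield_vec u v w = 0 \<longleftrightarrow> u = 0 \<and> v = 0 \<and> w = 0"
  by (simp add: subfield_vec_def eq_iff_re_im)

lemma subfield_vec_scale: "c *s subfield_vec u v w = subfield_vec (\<iota> c * u) (\<iota> c * v) (\<iota> c * w)"
  by (simp add: subfield_vec_def)

lemma subfield_vec_add: "subfield_vec u v w + subfield_vec u' v' w' = subfield_vec (u + u') (v + v') (w + w')"
  by (simp add: subfield_vec_def)

text \<open>The definition of \<open>bc_line\<close> allows every representative of the point; a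
  change of representative by a scalar is absorbed into the multiplier \<open>l\<close>.\<close>

lemma bc_line_proj_pt:
  assumes nz: "(u, v, w) \<noteq> (0, 0, 0)"
  shows "bc_line \<iota> \<epsilon> (proj_pt (hom4 0 u v w)) =
    {proj_pt (subfield_vec (l * u) (l * v) (l * w)) | l. l \<noteq> 0}" (is "?L = ?R")
proof
  show "?L \<subseteq> ?R"
  proof
    fix R assume "R \<in> ?L"
    then obtain u0 u1 v0 v1 w0 w1 u' v' w' l where
      R: "R = proj_pt (hom7 0 u0 u1 v0 v1 w0 w1)" and uvw': "(u', v', w') \<noteq> (0, 0, 0)"
      "proj_pt (hom4 0 u v w) = proj_pt (hom4 0 u' v' w')" and l: "l \<noteq> 0"
      and e: "elt u0 u1 = l * u'" "elt v0 v1 = l * v'" "elt w0 w1 = l * w'"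
      unfolding bc_line_def elt_def by blast
    obtain c where c: "c \<noteq> 0" "u' = c * u" "v' = c * v" "w' = c * w"
      using uvw' proj_pt_hom4_infinity by metis
    have "R = proj_pt (subfield_vec (l * u') (l * v') (l * w'))"
      unfolding R subfield_vec_def by (simp flip: e)
    then have "R = proj_pt (subfield_vec ((l * c) * u) ((l * c) * v) ((l * c) * w))"
      by (simp add: c mult.assoc)
    moreover have "l * c \<noteq> 0" using l c by simp
    ultimately show "R \<in> ?R" by blast
  qed
  show "?R \<subseteq> ?L"
  proof
    fix R assume "R \<in> ?R"
    then obtain l where l: "l \<noteq> 0" "R = proj_pt (subfield_vec (l * u) (l * v) (l * w))" by blast
    then show "R \<in> ?L"
      unfolding bc_line_def elt_def[symmetric] l(2) subfield_vec_def
      by (intro CollectI exI conjI) (rule refl nz l(1) elt_re_im)+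
  qed
qed

text \<open>The multiples of a nonzero vector are the image of the large field under an injective
  map linear over the subfield, so they form a space of dimension 2 with the images of 1 and
  \<epsilon> as a basis.\<close>

lemma bc_line_in_PG_lines:
  assumes nz: "(u, v, w) \<noteq> (0, 0, 0)"
  shows "bc_line \<iota> \<epsilon> (proj_pt (hom4 0 u v w)) \<in> PG_lines"
proof -
  let ?f = "\<lambda>l. subfield_vec (l * u) (l * v) (l * w)"
  have f_add: "?f l + ?f l' = ?f (l + l')" for l l'
    by (simp only: subfield_vec_add distrib_right)
  have f_scale: "c *s ?f l = ?f (\<iota> c * l)" for c l
    by (simp add: subfield_vec_scale mult.assoc)
  have f_inj: "?f l = ?f l' \<longleftrightarrow> l = l'" for l l'
    using nz by (auto simp: subfield_vec_inject)
  have f_0: "?f l = 0 \<longleftrightarrow> l = 0" for l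
    using nz by (auto simp: subfield_vec_eq_0)
  have sub: "vec.subspace (range ?f)"
  proof (rule vec.subspaceI)
    show "0 \<in> range ?f"
      using f_0[of 0] by (intro range_eqI[of _ _ 0]) simp
  next
    fix x y assume "x \<in> range ?f" "y \<in> range ?f"
    then obtain l l' where "x = ?f l" "y = ?f l'" by blast
    then have "x + y = ?f (l + l')" by (simp only: f_add)
    then show "x + y \<in> range ?f" by blast
  next
    fix c x assume "x \<in> range ?f"
    then obtain l where "x = ?f l" by blast
    then have "c *s x = ?f (\<iota> c * l)" by (simp only: f_scale)
    then show "c *s x \<in> range ?f" by blast
  qed
  have eps0: "\<epsilon> \<noteq> 0" using eps(1) rangeI[of \<iota> 0] by auto
  have "vec.dim (range ?f) = 2"
  proof (rule vec.dim_unique)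
    show "{?f 1, ?f \<epsilon>} \<subseteq> range ?f" by blast
    show "range ?f \<subseteq> vec.span {?f 1, ?f \<epsilon>}"
    proof
      fix x assume "x \<in> range ?f"
      then obtain l where x: "x = ?f l" by blast
      have l: "l = \<iota> (re l) * 1 + \<iota> (im l) * \<epsilon>"
        using elt_re_im[of l] by (simp add: elt_def mult.commute)
      have "x = re l *s ?f 1 + im l *s ?f \<epsilon>"
        unfolding f_scale f_add l[symmetric] by (rule x)
      moreover have "?f 1 \<in> vec.span {?f 1, ?f \<epsilon>}" "?f \<epsilon> \<in> vec.span {?f 1, ?f \<epsilon>}"
        by (rule vec.span_base, simp)+
      ultimately show "x \<in> vec.span {?f 1, ?f \<epsilon>}"
        by (simp only: vec.span_add vec.span_scale)
    qed
    have "?f 1 \<notin> vec.span {?f \<epsilon>}"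
    proof
      assume "?f 1 \<in> vec.span {?f \<epsilon>}"
      then obtain c where "?f 1 = c *s ?f \<epsilon>" by (auto simp: vec.span_singleton)
      then have "1 = \<iota> c * \<epsilon>" by (simp only: f_scale f_inj)
      then have "elt 1 0 = elt 0 c" by (simp add: elt_def mult.commute)
      then show False by simp
    qed
    moreover have "?f \<epsilon> \<noteq> 0" using eps0 f_0 by blast
    ultimately show "vec.independent {?f 1, ?f \<epsilon>}"
      by (simp add: vec.independent_insert)
    have "?f 1 \<noteq> ?f \<epsilon>" using eps(1) rangeI[of \<iota> 1] by (simp only: f_inj) auto
    then show "card {?f 1, ?f \<epsilon>} = 2" by simp
  qed
  moreover have "bc_line \<iota> \<epsilon> (proj_pt (hom4 0 u v w)) = points_of (range ?f)"
  proof
    show "bc_line \<iota> \<epsilon> (proj_pt (hom4 0 u v w)) \<subseteq> points_of (range ?f)"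
    proof
      fix P assume "P \<in> bc_line \<iota> \<epsilon> (proj_pt (hom4 0 u v w))"
      then obtain l where P: "P = proj_pt (?f l)" and "l \<noteq> 0"
        unfolding bc_line_proj_pt[OF nz] by blast
      then have "?f l \<noteq> 0" by (simp only: f_0 not_False_eq_True)
      then have "P \<in> PG_points" unfolding P PG_points_def by blast
      moreover have "P \<subseteq> range ?f" unfolding P proj_pt_subset_iff[OF sub] by blast
      ultimately show "P \<in> points_of (range ?f)" by (simp add: points_of_def)
    qed
    show "points_of (range ?f) \<subseteq> bc_line \<iota> \<epsilon> (proj_pt (hom4 0 u v w))"
    proof
      fix P assume "P \<in> points_of (range ?f)"
      then obtain x where x: "P = proj_pt x" "x \<noteq> 0" "proj_pt x \<subseteq> range ?f"
        unfolding points_of_def PG_points_def by blast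
      from x(3) have "x \<in> range ?f" by (simp only: proj_pt_subset_iff[OF sub])
      then obtain l where l: "x = ?f l" by blast
      with x(2) have "l \<noteq> 0" by (simp only: f_0 not_False_eq_True)
      with x(1) l have "P = proj_pt (?f l)" "l \<noteq> 0" by simp_all
      then show "P \<in> bc_line \<iota> \<epsilon> (proj_pt (hom4 0 u v w))"
        unfolding bc_line_proj_pt[OF nz] by blast
    qed
  qed
  ultimately show ?thesis unfolding PG_lines_def using sub by blast
qed

text \<open>One common point of the two lines suffices: the subfield scalar between its two
  representatives and the multiplier \<open>l\<close> combine to a scalar of the large field
  relating the original vectors.\<close>

lemma bc_line_inject:
  assumes nz: "(u, v, w) \<noteq> (0, 0, 0)" "(u', v', w') \<noteq> (0, 0, 0)"
    and eq: "bc_line \<iota> \<epsilon> (proj_pt (hom4 0 u v w)) = bc_line \<iota> \<epsilon> (proj_pt (hom4 0 u' v' w'))"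
  shows "proj_pt (hom4 0 u v w) = proj_pt (hom4 0 u' v' w')"
proof -
  have "proj_pt (subfield_vec (1 * u) (1 * v) (1 * w)) \<in> bc_line \<iota> \<epsilon> (proj_pt (hom4 0 u v w))"
    unfolding bc_line_proj_pt[OF nz(1)] using one_neq_zero by blast
  then obtain l where l: "l \<noteq> 0"
    "proj_pt (subfield_vec u v w) = proj_pt (subfield_vec (l * u') (l * v') (l * w'))"
    unfolding eq bc_line_proj_pt[OF nz(2)] by auto
  have "subfield_vec u v w \<noteq> 0" using nz(1) by (auto simp: subfield_vec_eq_0)
  with l(2) obtain c where c: "c \<noteq> 0"
    "subfield_vec u v w = c *s subfield_vec (l * u') (l * v') (l * w')"
    by (auto simp: proj_pt_eq_iff)
  then have "u = (\<iota> c * l) * u'" "v = (\<iota> c * l) * v'" "w = (\<iota> c * l) * w'"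
    by (simp_all add: subfield_vec_scale subfield_vec_inject)
  moreover have "\<iota> c * l \<noteq> 0" using c(1) l(1) by simp
  ultimately show ?thesis unfolding proj_pt_hom4_infinity[OF nz(1)] by blast
qed

lemma inj_on_bc_line: "inj_on (bc_line \<iota> \<epsilon>) (BM_infinity n)"
  unfolding BM_infinity_def
  by (rule inj_onI, elim CollectE exE conjE, hypsubst, rule bc_line_inject)

lemma bc_line_subset_quadric:
  assumes "a = elt a0 a1" "b = elt b0 b1" "a \<noteq> 0" and nz: "(u, v, w) \<noteq> (0, 0, 0)"
    and inf: "u ^ (CARD('f) + 1) + v ^ (CARD('f) + 1) = 0"
  shows "bc_line \<iota> \<epsilon> (proj_pt (hom4 0 u v w)) \<subseteq> quadric (cone_form \<delta> a0 a1 b1) \<longleftrightarrow> u = v"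
proof -
  have form: "cone_form \<delta> a0 a1 b1 (subfield_vec (l * u) (l * v) (l * w)) = im (l\<^sup>2 * (a * (u + v)\<^sup>2))" for l
  proof -
    \<comment> \<open>The norm is multiplicative, so \<open>inf\<close> removes the term with
      \<open>b\<close> for every multiplier at once.\<close>
    have "(l * u) ^ (CARD('f) + 1) + (l * v) ^ (CARD('f) + 1) = 0"
      using inf unfolding power_mult_distrib distrib_left[symmetric] by simp
    then show ?thesis
      unfolding subfield_vec_def cone_form_re_im[OF assms(1,2)]
      by (simp add: square_add_g power_mult_distrib algebra_simps del: power_Suc)
  qed
  have "bc_line \<iota> \<epsilon> (proj_pt (hom4 0 u v w)) \<subseteq> quadric (cone_form \<delta> a0 a1 b1) \<longleftrightarrow>
      (\<forall>l. l \<noteq> 0 \<longrightarrow> im (l\<^sup>2 * (a * (u + v)\<^sup>2)) = 0)"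
  proof -
    have "proj_pt (subfield_vec (l * u) (l * v) (l * w)) \<in> quadric (cone_form \<delta> a0 a1 b1) \<longleftrightarrow>
        im (l\<^sup>2 * (a * (u + v)\<^sup>2)) = 0" if "l \<noteq> 0" for l
      using nz that by (subst proj_pt_in_cone_form_quadric) (auto simp: subfield_vec_eq_0 form)
    then show ?thesis unfolding bc_line_proj_pt[OF nz] by blast
  qed
  also have "\<dots> \<longleftrightarrow> u = v"
  proof
    assume *: "\<forall>l. l \<noteq> 0 \<longrightarrow> im (l\<^sup>2 * (a * (u + v)\<^sup>2)) = 0"
    show "u = v"
    proof (rule ccontr)
      assume "u \<noteq> v"
      then have k: "a * (u + v)\<^sup>2 \<noteq> 0" using \<open>a \<noteq> 0\<close> by (simp add: add_eq_0_g)
      \<comment> \<open>The multiplier is chosen so that the form takes the value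
        \<open>im \<epsilon>\<close>, which is nonzero as \<epsilon> lies outside the
        subfield.\<close>
      obtain l where l: "l\<^sup>2 = \<epsilon> / (a * (u + v)\<^sup>2)"
        using bij_is_surj[OF square_bij] by (metis surjD)
      have eps0: "\<epsilon> \<noteq> 0" using eps(1) rangeI[of \<iota> 0] by auto
      have "l\<^sup>2 * (a * (u + v)\<^sup>2) = \<epsilon>" using k by (simp add: l)
      moreover from this have "l \<noteq> 0" using eps0 by auto
      ultimately have "im \<epsilon> = 0" using * by metis
      then show False using eps(1) by (simp add: in_range_iota)
    qed
  qed (simp add: double_g)
  finally show ?thesis .
qed

section \<open>Counting the points at infinity and the lines on the cone\<close>

lemma BM_infinity_eq:
  "BM_infinity (CARD('f)) = insert (proj_pt (hom4 0 0 0 1))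
     ((\<lambda>(y, z :: 'g). proj_pt (hom4 0 1 y z)) ` ({y. y ^ (CARD('f) + 1) = 1} \<times> UNIV))"
  (is "?L = insert ?P (?f ` ?S)")
proof
  show "?L \<subseteq> insert ?P (?f ` ?S)"
  proof
    fix P assume "P \<in> ?L"
    then obtain x y z where P: "P = proj_pt (hom4 0 x y z)" "(x, y, z) \<noteq> (0, 0, 0)"
      "x ^ (CARD('f) + 1) = y ^ (CARD('f) + 1)"
      unfolding BM_infinity_def add_eq_0_g by blast
    show "P \<in> insert ?P (?f ` ?S)"
    proof (cases "x = 0")
      case True
      then have "y = 0" using P(3) by simp
      then have "P = ?P" using P True by (simp add: proj_pt_hom4_infinity)
      then show ?thesis by blast
    next
      case False
      then have "P = ?f (y / x, z / x)"
        using P by (simp add: proj_pt_hom4_infinity exI[of _ x])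
      moreover have "(y / x) ^ (CARD('f) + 1) = 1"
        using P(3) False unfolding power_divide by (metis divide_self power_not_zero)
      ultimately show ?thesis by blast
    qed
  qed
  show "insert ?P (?f ` ?S) \<subseteq> ?L"
  proof -
    have "?P \<in> ?L" unfolding BM_infinity_def
      by (rule CollectI, rule exI[of _ 0], rule exI[of _ 0], rule exI[of _ 1]) simp
    moreover have "proj_pt (hom4 0 1 y z) \<in> ?L" if "y ^ (CARD('f) + 1) = 1" for y z
      unfolding BM_infinity_def add_eq_0_g
      by (rule CollectI, rule exI[of _ 1], rule exI[of _ y], rule exI[of _ z]) (use that in simp)
    ultimately show ?thesis by auto
  qed
qed

text \<open>The set \<open>Y\<close> is left arbitrary to serve both counts: the elements of norm 1
  for all points at infinity, and \<open>{1}\<close> for those whose line lies on the cone.\<close>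

lemma card_points_001_1yz:
  "card (insert (proj_pt (hom4 0 0 0 1)) ((\<lambda>(y, z :: 'g). proj_pt (hom4 0 1 y z)) ` (Y \<times> UNIV)))
     = card Y * CARD('f)\<^sup>2 + 1"
proof -
  let ?f = "\<lambda>(y, z :: 'g). proj_pt (hom4 0 1 y z)"
  have "inj_on ?f (Y \<times> UNIV)" by (auto simp: inj_on_def proj_pt_hom4_infinity)
  then have "card (?f ` (Y \<times> UNIV)) = card Y * CARD('f)\<^sup>2"
    by (simp add: card_image card_cartesian_product card_g)
  moreover have "proj_pt (hom4 0 0 0 1) \<notin> ?f ` (Y \<times> UNIV)"
    by (auto simp: proj_pt_hom4_infinity)
  ultimately show ?thesis by simp
qed

text \<open>There are q + 1 elements of norm 1, which gives \<open>(q + 1) * q\<^sup>2 + 1\<close>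
  points.\<close>

lemma card_BM_infinity: "card (BM_infinity (CARD('f)) :: ('g^4) set set) = CARD('f) ^ 3 + CARD('f) ^ 2 + 1"
  unfolding BM_infinity_eq card_points_001_1yz
  using card_norm_fibre[of 1] by (simp add: power2_eq_square power3_eq_cube algebra_simps)

text \<open>The criterion of equal first two coordinates holds at (0,0,0,1), where both are zero,
  and selects \<open>y = 1\<close> among the remaining points.\<close>

lemma BM_infinity_lines_in_quadric:
  assumes "a = elt a0 a1" "b = elt b0 b1" "a \<noteq> 0"
  shows "{P \<in> BM_infinity (CARD('f)). bc_line \<iota> \<epsilon> P \<subseteq> quadric (cone_form \<delta> a0 a1 b1)} =
    insert (proj_pt (hom4 0 0 0 1)) ((\<lambda>(y, z :: 'g). proj_pt (hom4 0 1 y z)) ` ({1} \<times> UNIV))"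
proof -
  have 1: "bc_line \<iota> \<epsilon> (proj_pt (hom4 0 0 0 1)) \<subseteq> quadric (cone_form \<delta> a0 a1 b1)"
    by (subst bc_line_subset_quadric[OF assms]) auto
  have *: "bc_line \<iota> \<epsilon> (proj_pt (hom4 0 1 y z)) \<subseteq> quadric (cone_form \<delta> a0 a1 b1) \<longleftrightarrow> y = 1"
    if "y ^ (CARD('f) + 1) = 1" for y z
    by (subst bc_line_subset_quadric[OF assms]) (use that in \<open>auto simp: double_g simp del: power_Suc\<close>)
  show ?thesis (is "?L = ?R")
  proof
    show "?L \<subseteq> ?R"
    proof
      fix P assume P: "P \<in> ?L"
      then have sub: "bc_line \<iota> \<epsilon> P \<subseteq> quadric (cone_form \<delta> a0 a1 b1)" by simp
      from P have "P = proj_pt (hom4 0 0 0 1) \<or> (\<exists>y z. P = proj_pt (hom4 0 1 y z) \<and> y ^ (CARD('f) + 1) = 1)"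
        unfolding BM_infinity_eq by (auto simp del: power_Suc)
      then consider "P = proj_pt (hom4 0 0 0 1)"
        | y z where "P = proj_pt (hom4 0 1 y z)" "y ^ (CARD('f) + 1) = 1"
        by blast
      then show "P \<in> ?R"
      proof cases
        case 2
        then have "P = proj_pt (hom4 0 1 1 z)" using * sub by simp
        then show ?thesis by blast
      qed blast
    qed
    have "bc_line \<iota> \<epsilon> (proj_pt (hom4 0 1 1 z)) \<subseteq> quadric (cone_form \<delta> a0 a1 b1)" for z
      by (subst *) simp_all
    then have "proj_pt (hom4 0 1 1 z) \<in> ?L" for z
      unfolding BM_infinity_eq by (intro CollectI conjI insertI2 image_eqI[of _ _ "(1, z)"]) simp_all
    moreover have "proj_pt (hom4 0 0 0 1) \<in> ?L"
      unfolding BM_infinity_eq using 1 by simp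
    ultimately show "?R \<subseteq> ?L" by auto
  qed
qed

end

theorem theorem6p3:
  fixes \<iota> :: "'f::{field,finite} \<Rightarrow> 'g::{field,finite}"
    and q h :: nat
    and \<delta> a0 a1 b0 b1 :: 'f
    and \<epsilon> a b :: 'g
    and M :: "('g^4) set set"
    and B :: "('f^7) set set"
    and base :: "('f^6) set set"
    and L :: "('f^7) set set set"
    and V :: "('f^7) set"
  assumes "q = CARD('f)" and "CARD('g) = q\<^sup>2" and "field_embedding \<iota>"
    and "q = 2 ^ h" and "q > 2"
    and "abs_trace2 h \<delta> = 1"
    and "\<epsilon> \<notin> range \<iota>" and "\<epsilon>\<^sup>2 + \<epsilon> + \<iota> \<delta> = 0"
    and "a = \<iota> a0 + \<epsilon> * \<iota> a1" and "a \<noteq> 0"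
    and "b = \<iota> b0 + \<epsilon> * \<iota> b1" and "b \<notin> range \<iota>"
  defines "M \<equiv> BM_variety \<iota> a b"
    and "B \<equiv> quadric (cone_form \<delta> a0 a1 b1)"
    and "base \<equiv> quadric (cone_form \<delta> a0 a1 b1 \<circ> base_incl)"
    and "V \<equiv> proj_pt (hom7 0 0 0 0 0 1 0)"
    and "L \<equiv> bc_line \<iota> \<epsilon> ` infinite_part M"
  shows "bij_betw (bc_affine \<iota> \<epsilon>) (affine_part M) (affine_part B)
    \<and> singular_points (cone_form \<delta> a0 a1 b1) = {V}
    \<and> B = cone_over V ((\<lambda>P. base_incl ` P) ` base)
    \<and> hyperbolic_quadric5 base
    \<and> L = bc_line \<iota> \<epsilon> ` BM_infinity q
    \<and> L \<subseteq> bc_spread \<iota> \<epsilon>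
    \<and> L \<subseteq> PG_lines
    \<and> card L = q ^ 3 + q ^ 2 + 1
    \<and> card {r \<in> L. r \<subseteq> B} = q\<^sup>2 + 1"
proof -
  interpret quadratic_extension \<iota> \<epsilon> \<delta> h
    by unfold_locales (use assms in simp_all)
  have a: "a = elt a0 a1" and b: "b = elt b0 b1"
    using assms by (simp_all add: elt_def)
  \<comment> \<open>That \<open>b\<close> lies outside the subfield enters through its nonzero
    \<epsilon>-coordinate.\<close>
  have b1: "b1 \<noteq> 0" using \<open>b \<notin> range \<iota>\<close> by (simp add: in_range_iota b)
  have L: "L = bc_line \<iota> \<epsilon> ` BM_infinity q"
    by (simp add: L_def M_def infinite_part_BM \<open>q = CARD('f)\<close>)
  have "BM_infinity q \<subseteq> infinite_part (PG_points :: ('g^4) set set)"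
  proof
    fix P :: "('g^4) set" assume "P \<in> BM_infinity q"
    then obtain x y z where P: "P = proj_pt (hom4 0 x y z)" "(x, y, z) \<noteq> (0, 0, 0)"
      unfolding BM_infinity_def by blast
    then have "hom4 0 x y z \<noteq> 0" by auto
    then show "P \<in> infinite_part PG_points"
      unfolding P(1) infinite_part_def PG_points_def mem_Collect_eq proj_pt_subset_hyperplane_inf
      by (auto simp del: hom4_eq_0)
  qed
  then have spread: "L \<subseteq> bc_spread \<iota> \<epsilon>"
    unfolding L bc_spread_def by (rule image_mono)
  have lines: "L \<subseteq> PG_lines"
    unfolding L BM_infinity_def
    by (intro image_subsetI, elim CollectE exE conjE, hypsubst) (rule bc_line_in_PG_lines)
  have card: "card L = q ^ 3 + q ^ 2 + 1"
    unfolding L using card_BM_infinity by (simp add: card_image[OF inj_on_bc_line] \<open>q = CARD('f)\<close>)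
  have card_B: "card {r \<in> L. r \<subseteq> B} = q\<^sup>2 + 1"
  proof -
    \<comment> \<open>Distinct points at infinity give distinct lines, so the lines on the cone are
      counted by their points.\<close>
    let ?I = "{P \<in> BM_infinity q. bc_line \<iota> \<epsilon> P \<subseteq> B}"
    have "{r \<in> L. r \<subseteq> B} = bc_line \<iota> \<epsilon> ` ?I" unfolding L by blast
    moreover have "inj_on (bc_line \<iota> \<epsilon>) ?I"
      by (rule inj_on_subset[OF inj_on_bc_line]) blast
    ultimately have "card {r \<in> L. r \<subseteq> B} = card ?I" by (simp add: card_image)
    then show ?thesis
      unfolding B_def \<open>q = CARD('f)\<close> BM_infinity_lines_in_quadric[OF a b \<open>a \<noteq> 0\<close>] card_points_001_1yz
      by simp
  qed
  have bij: "bij_betw (bc_affine \<iota> \<epsilon>) (affine_part M) (affine_part B)"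
    unfolding M_def B_def by (rule bij_betw_affine_parts[OF a b])
  have vertex: "singular_points (cone_form \<delta> a0 a1 b1) = {V}"
    unfolding V_def by (rule singular_points_cone_form[OF char2_f b1])
  have cone: "B = cone_over V ((\<lambda>P. base_incl ` P) ` base)"
    unfolding B_def V_def base_def by (rule quadric_cone_form_eq_cone)
  have hyp: "hyperbolic_quadric5 base"
    unfolding base_def by (rule hyperbolic_quadric5_base[OF char2_f b1])
  show ?thesis
    by (intro conjI bij vertex cone hyp L spread lines card card_B)
qed

end
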